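(* Let $G$ be a compact group, $K$ a closed subgroup, $\mathscr X=G/K$, $\tau$ an irreducible unitary representation of $K$ on a finite-dimensional complex Hilbert space $H$, and $\xi_\tau=(G\times_\tau H,\pi_\tau,\mathscr X)$ the associated homogeneous vector bundle. Given a section $u$ of $\xi_\tau$, there exists a unique function $f:G\to H$ of type $\tau$ such that $u(x)=\theta(g,f(g))$ whenever $gK=x$. Moreover $u$ is continuous if and only if $f:G\to H$ is continuous.
   Context: $K$ acts on $G\times H$ by $k(g,z)=(gk,\tau(k^{-1})z)$; $\theta(g,z)$ denotes the orbit of $(g,z)$ and $G\times_\tau H$ the quotient space of orbits with the quotient topology; $\pi_\tau(\theta(g,z))=gK$. A section of $\xi_\tau$ is a map $u:\mathscr X\to G\times_\tau H$ with $\pi_\tau\circ u=\mathrm{id}_{\mathscr X}$. A function $f:G\to H$ is of type $\tau$ if $f(gk)=\tau(k^{-1})f(g)$ for all $g\in G$, $k\in K$. *)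

theory Defs
  imports "HOL-Analysis.Analysis" "HOL-Algebra.Left_Coset"
begin

section \<open>Complex Hilbert spaces\<close>

text \<open>
  Positive definiteness of \<open>cinner\<close> and the fact that the norm is induced by it are inherited from
  \<open>real_inner\<close> through the last axiom. \<open>cinner\<close> is linear in its first argument.
\<close>

class complex_inner = real_inner +
  fixes scaleC :: "complex \<Rightarrow> 'a \<Rightarrow> 'a"
    and cinner :: "'a \<Rightarrow> 'a \<Rightarrow> complex"
  assumes scaleC_add_right: "scaleC a (x + y) = scaleC a x + scaleC a y"
    and scaleC_add_left: "scaleC (a + b) x = scaleC a x + scaleC b x"
    and scaleC_scaleC: "scaleC a (scaleC b x) = scaleC (a * b) x"
    and scaleC_one: "scaleC 1 x = x"
    and scaleR_scaleC: "scaleR r x = scaleC (complex_of_real r) x"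
    and cinner_commute: "cinner x y = cnj (cinner y x)"
    and cinner_add_left: "cinner (x + y) z = cinner x z + cinner y z"
    and cinner_scaleC_left: "cinner (scaleC a x) y = a * cinner x y"
    and inner_eq_Re_cinner: "inner x y = Re (cinner x y)"

class chilbert_space = complex_inner + complete_space

lemma vector_space_scaleC: "vector_space (scaleC :: complex \<Rightarrow> 'h::complex_inner \<Rightarrow> 'h)"
  by unfold_locales
    (simp_all add: scaleC_add_right scaleC_add_left scaleC_scaleC scaleC_one)

definition complex_finite_dim :: "'h::complex_inner itself \<Rightarrow> bool" where
  "complex_finite_dim _ \<longleftrightarrow>
     (\<exists>B :: 'h set. finite_dimensional_vector_space (scaleC :: complex \<Rightarrow> 'h \<Rightarrow> 'h) B)"

definition unitary_operator :: "('h::complex_inner \<Rightarrow> 'h) \<Rightarrow> bool" where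
  "unitary_operator A \<longleftrightarrow>
     Vector_Spaces.linear scaleC scaleC A \<and> surj A \<and> (\<forall>x y. cinner (A x) (A y) = cinner x y)"


section \<open>Topological groups and unitary representations\<close>

text \<open>Topological groups are not required to be Hausdorff.\<close>

locale topological_group = group G for G (structure) +
  fixes T :: "'g topology"
  assumes topspace_eq: "topspace T = carrier G"
    and continuous_mult: "continuous_map (prod_topology T T) T (\<lambda>(x, y). x \<otimes> y)"
    and continuous_inv: "continuous_map T T (\<lambda>x. inv x)"

text \<open>
  Representations are continuous in the strong operator topology. Only the values of \<open>\<tau>\<close> on the
  carrier of the group matter.
\<close>

definition unitary_representation ::
    "('g, 'm) monoid_scheme \<Rightarrow> 'g topology \<Rightarrow> ('g \<Rightarrow> 'h::chilbert_space \<Rightarrow> 'h) \<Rightarrow> bool" where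
  "unitary_representation G T \<tau> \<longleftrightarrow>
     (\<forall>k\<in>carrier G. unitary_operator (\<tau> k)) \<and>
     \<tau> \<one>\<^bsub>G\<^esub> = id \<and>
     (\<forall>k\<in>carrier G. \<forall>l\<in>carrier G. \<tau> (k \<otimes>\<^bsub>G\<^esub> l) = \<tau> k \<circ> \<tau> l) \<and>
     (\<forall>z. continuous_map T euclidean (\<lambda>k. \<tau> k z))"

definition irreducible_representation ::
    "('g, 'm) monoid_scheme \<Rightarrow> ('g \<Rightarrow> 'h::chilbert_space \<Rightarrow> 'h) \<Rightarrow> bool" where
  "irreducible_representation G \<tau> \<longleftrightarrow>
     (UNIV :: 'h set) \<noteq> {0} \<and>
     (\<forall>V. module.subspace scaleC V \<and> closed V \<and> (\<forall>k\<in>carrier G. \<tau> k ` V \<subseteq> V)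
          \<longrightarrow> V = {0} \<or> V = UNIV)"


section \<open>Quotient topologies\<close>

definition quotient_topology :: "'a topology \<Rightarrow> ('a \<Rightarrow> 'b) \<Rightarrow> 'b topology" where
  "quotient_topology X p =
     topology (\<lambda>U. U \<subseteq> p ` topspace X \<and> openin X {x \<in> topspace X. p x \<in> U})"

lemma openin_quotient_topology:
  "openin (quotient_topology X p) U \<longleftrightarrow>
     U \<subseteq> p ` topspace X \<and> openin X {x \<in> topspace X. p x \<in> U}"
proof -
  have "istopology (\<lambda>U. U \<subseteq> p ` topspace X \<and> openin X {x \<in> topspace X. p x \<in> U})"
    unfolding istopology_def
  proof (intro conjI allI impI)
    fix S S'
    assume S: "S \<subseteq> p ` topspace X \<and> openin X {x \<in> topspace X. p x \<in> S}"
      and S': "S' \<subseteq> p ` topspace X \<and> openin X {x \<in> topspace X. p x \<in> S'}"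
    have "{x \<in> topspace X. p x \<in> S \<inter> S'} =
          {x \<in> topspace X. p x \<in> S} \<inter> {x \<in> topspace X. p x \<in> S'}"
      by blast
    with S S' show "openin X {x \<in> topspace X. p x \<in> S \<inter> S'}"
      by auto
    show "S \<inter> S' \<subseteq> p ` topspace X"
      using S by blast
  next
    fix \<K>
    assume K: "\<forall>S\<in>\<K>. S \<subseteq> p ` topspace X \<and> openin X {x \<in> topspace X. p x \<in> S}"
    have "{x \<in> topspace X. p x \<in> \<Union>\<K>} = (\<Union>S\<in>\<K>. {x \<in> topspace X. p x \<in> S})"
      by blast
    with K show "openin X {x \<in> topspace X. p x \<in> \<Union>\<K>}"
      by auto
    show "\<Union>\<K> \<subseteq> p ` topspace X"
      using K by blast
  qed
  then show ?thesis
    by (simp add: quotient_topology_def topology_inverse')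
qed

lemma topspace_quotient_topology [simp]: "topspace (quotient_topology X p) = p ` topspace X"
proof
  show "topspace (quotient_topology X p) \<subseteq> p ` topspace X"
    by (metis openin_quotient_topology openin_topspace)
  have "{x \<in> topspace X. p x \<in> p ` topspace X} = topspace X"
    by blast
  then have "openin (quotient_topology X p) (p ` topspace X)"
    by (simp add: openin_quotient_topology)
  then show "p ` topspace X \<subseteq> topspace (quotient_topology X p)"
    by (rule openin_subset)
qed

lemma quotient_map_quotient_topology: "quotient_map X (quotient_topology X p) p"
  by (auto simp: quotient_map_def openin_quotient_topology)


section \<open>The homogeneous vector bundle of a representation\<close>

definition coset_topology ::
    "('g, 'm) monoid_scheme \<Rightarrow> 'g topology \<Rightarrow> 'g set \<Rightarrow> 'g set topology" where
  "coset_topology G T K = quotient_topology T (\<lambda>g. g <#\<^bsub>G\<^esub> K)"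

definition bundle_action ::
    "('g, 'm) monoid_scheme \<Rightarrow> ('g \<Rightarrow> 'h \<Rightarrow> 'h) \<Rightarrow> 'g \<Rightarrow> 'g \<times> 'h \<Rightarrow> 'g \<times> 'h" where
  "bundle_action G \<tau> k = (\<lambda>(g, z). (g \<otimes>\<^bsub>G\<^esub> k, \<tau> (inv\<^bsub>G\<^esub> k) z))"

definition bundle_orbit ::
    "('g, 'm) monoid_scheme \<Rightarrow> 'g set \<Rightarrow> ('g \<Rightarrow> 'h \<Rightarrow> 'h) \<Rightarrow> 'g \<times> 'h \<Rightarrow> ('g \<times> 'h) set" where
  "bundle_orbit G K \<tau> p = (\<lambda>k. bundle_action G \<tau> k p) ` K"

definition bundle_space ::
    "('g, 'm) monoid_scheme \<Rightarrow> 'g set \<Rightarrow> ('g \<Rightarrow> 'h \<Rightarrow> 'h) \<Rightarrow> ('g \<times> 'h) set set" where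
  "bundle_space G K \<tau> = bundle_orbit G K \<tau> ` (carrier G \<times> UNIV)"

definition bundle_topology ::
    "('g, 'm) monoid_scheme \<Rightarrow> 'g topology \<Rightarrow> 'g set \<Rightarrow> ('g \<Rightarrow> 'h::topological_space \<Rightarrow> 'h) \<Rightarrow>
     ('g \<times> 'h) set topology" where
  "bundle_topology G T K \<tau> =
     quotient_topology (prod_topology T euclidean) (bundle_orbit G K \<tau>)"

definition bundle_proj ::
    "('g, 'm) monoid_scheme \<Rightarrow> 'g set \<Rightarrow> ('g \<Rightarrow> 'h \<Rightarrow> 'h) \<Rightarrow> ('g \<times> 'h) set \<Rightarrow> 'g set" where
  "bundle_proj G K \<tau> c =
     (THE x. \<exists>g\<in>carrier G. \<exists>z. c = bundle_orbit G K \<tau> (g, z) \<and> x = g <#\<^bsub>G\<^esub> K)"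

lemma bundle_proj_bundle_orbit:
  assumes "g \<in> carrier G"
  shows "bundle_proj G K \<tau> (bundle_orbit G K \<tau> (g, z)) = g <#\<^bsub>G\<^esub> K"
proof -
  have fst_orbit: "fst ` bundle_orbit G K \<tau> (h, w) = h <#\<^bsub>G\<^esub> K" for h w
    by (auto simp: bundle_orbit_def bundle_action_def l_coset_def image_iff)
  show ?thesis
    unfolding bundle_proj_def
    by (rule the_equality) (use assms fst_orbit in metis)+
qed

definition bundle_section ::
    "('g, 'm) monoid_scheme \<Rightarrow> 'g set \<Rightarrow> ('g \<Rightarrow> 'h \<Rightarrow> 'h) \<Rightarrow>
     ('g set \<Rightarrow> ('g \<times> 'h) set) \<Rightarrow> bool" where
  "bundle_section G K \<tau> u \<longleftrightarrow>
     u \<in> (lcosets\<^bsub>G\<^esub> K) \<rightarrow> bundle_space G K \<tau> \<and>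
     (\<forall>x\<in>lcosets\<^bsub>G\<^esub> K. bundle_proj G K \<tau> (u x) = x)"

text \<open>
  A function on the group is an element of \<open>carrier G \<rightarrow>\<^sub>E UNIV\<close>, i.e. it is \<open>undefined\<close> outside the
  carrier, so that equality of HOL functions is equality of functions on the group.
\<close>

definition function_of_type ::
    "('g, 'm) monoid_scheme \<Rightarrow> 'g set \<Rightarrow> ('g \<Rightarrow> 'h \<Rightarrow> 'h) \<Rightarrow> ('g \<Rightarrow> 'h) \<Rightarrow> bool" where
  "function_of_type G K \<tau> f \<longleftrightarrow>
     f \<in> carrier G \<rightarrow>\<^sub>E UNIV \<and>
     (\<forall>g\<in>carrier G. \<forall>k\<in>K. f (g \<otimes>\<^bsub>G\<^esub> k) = \<tau> (inv\<^bsub>G\<^esub> k) (f g))"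

definition function_represents_section ::
    "('g, 'm) monoid_scheme \<Rightarrow> 'g set \<Rightarrow> ('g \<Rightarrow> 'h \<Rightarrow> 'h) \<Rightarrow>
     ('g \<Rightarrow> 'h) \<Rightarrow> ('g set \<Rightarrow> ('g \<times> 'h) set) \<Rightarrow> bool" where
  "function_represents_section G K \<tau> f u \<longleftrightarrow>
     (\<forall>x\<in>lcosets\<^bsub>G\<^esub> K. \<forall>g\<in>carrier G.
        g <#\<^bsub>G\<^esub> K = x \<longrightarrow> u x = bundle_orbit G K \<tau> (g, f g))"

end

(*
  The orbit map theta is injective on each fibre {g} x H, and every point of the bundle over gK
  lies in theta({g} x H); this gives the function f pointwise. If f is continuous then so is
  g |-> theta(g, f g) = u(gK), and u is continuous because G -> G/K is a quotient map.
  Conversely, theta is an open map, being the orbit map of an action by homeomorphisms. So if u is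
  continuous and g is close to g0, then theta(g, f g) = theta(h, w) for some h close to g0 and w
  close to f g0, whence f g = tau(g^-1 h) w, which is close to f g0 by strong continuity and
  isometry of tau.
*)

theory Submission
  imports Defs
begin

section \<open>Unitary operators as continuous isometries\<close>

lemma unitary_operator_diff:
  assumes "unitary_operator A"
  shows "A (x - y) = A x - A y"
  using assms module_hom.diff unfolding unitary_operator_def module_hom_iff_linear[symmetric]
  by blast

lemma unitary_operator_norm:
  assumes "unitary_operator A"
  shows "norm (A x) = norm x"
  using assms by (simp add: unitary_operator_def norm_eq_sqrt_inner inner_eq_Re_cinner)

lemma unitary_operator_dist:
  assumes "unitary_operator A"
  shows "dist (A x) (A y) = dist x y"
  using unitary_operator_norm[OF assms, of "x - y"]
  by (simp add: dist_norm unitary_operator_diff[OF assms])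

lemma unitary_operator_continuous:
  assumes "unitary_operator A"
  shows "continuous_map euclidean euclidean A"
proof -
  have "continuous_on UNIV A"
    unfolding continuous_on_iff using unitary_operator_dist[OF assms] by metis
  then show ?thesis
    by simp
qed

section \<open>Continuity of the group operations along continuous maps\<close>

context topological_group
begin

lemma continuous_map_mult:
  assumes "continuous_map X T p" and "continuous_map X T q"
  shows "continuous_map X T (\<lambda>x. p x \<otimes> q x)"
  using continuous_map_compose[OF continuous_map_pairedI[OF assms] continuous_mult]
  by (simp add: o_def)

lemma continuous_map_inv:
  assumes "continuous_map X T p"
  shows "continuous_map X T (\<lambda>x. inv (p x))"
  using continuous_map_compose[OF assms continuous_inv] by (simp add: o_def)

lemma continuous_map_right_translation:
  assumes "k \<in> carrier G"
  shows "continuous_map T T (\<lambda>g. g \<otimes> k)"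
  using assms by (intro continuous_map_mult) (auto simp: topspace_eq)

end

section \<open>Orbits of the \<open>K\<close>-action and fibres of the bundle\<close>

locale homogeneous_bundle = topological_group G T for G (structure) and T +
  fixes K :: "'a set" and \<tau> :: "'a \<Rightarrow> 'h::chilbert_space \<Rightarrow> 'h"
  assumes subgroup_K: "subgroup K G"
    and rep: "unitary_representation (G\<lparr>carrier := K\<rparr>) (subtopology T K) \<tau>"
begin

abbreviation \<theta> :: "'a \<times> 'h \<Rightarrow> ('a \<times> 'h) set" where
  "\<theta> \<equiv> bundle_orbit G K \<tau>"

lemma K_carrier: "k \<in> K \<Longrightarrow> k \<in> carrier G"
  using subgroup.mem_carrier[OF subgroup_K] .

lemma K_inv: "k \<in> K \<Longrightarrow> inv k \<in> K"
  using subgroup.m_inv_closed[OF subgroup_K] .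

lemma K_mult: "k \<in> K \<Longrightarrow> l \<in> K \<Longrightarrow> k \<otimes> l \<in> K"
  using subgroup.m_closed[OF subgroup_K] .

lemma K_one: "\<one> \<in> K"
  using subgroup.one_closed[OF subgroup_K] .

lemma unitary: "k \<in> K \<Longrightarrow> unitary_operator (\<tau> k)"
  using rep by (simp add: unitary_representation_def)

lemma rep_one: "\<tau> \<one> z = z"
  using rep by (simp add: unitary_representation_def)

lemma rep_mult: "k \<in> K \<Longrightarrow> l \<in> K \<Longrightarrow> \<tau> (k \<otimes> l) z = \<tau> k (\<tau> l z)"
  using rep by (simp add: unitary_representation_def)

lemma rep_continuous: "continuous_map (subtopology T K) euclidean (\<lambda>k. \<tau> k z)"
  using rep by (simp add: unitary_representation_def)

lemma mem_orbit_iff: "(h, w) \<in> \<theta> (g, z) \<longleftrightarrow> (\<exists>k\<in>K. h = g \<otimes> k \<and> w = \<tau> (inv k) z)"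
  by (auto simp: bundle_orbit_def bundle_action_def)

lemma orbit_self:
  assumes "g \<in> carrier G"
  shows "(g, z) \<in> \<theta> (g, z)"
  unfolding mem_orbit_iff using K_one assms by (intro bexI[of _ \<one>]) (auto simp: rep_one)

text \<open>Acting by \<open>k\<close> and then by \<open>l\<close> is acting by
  \<open>k \<otimes> l\<close>: inversion reverses products, so the inverse in
  \<open>bundle_action\<close> turns the left action \<open>\<tau>\<close> into a right one.\<close>

lemma orbit_translate_subset:
  assumes "g \<in> carrier G" and "k \<in> K"
  shows "\<theta> (g \<otimes> k, \<tau> (inv k) z) \<subseteq> \<theta> (g, z)"
proof clarify
  fix h w
  assume "(h, w) \<in> \<theta> (g \<otimes> k, \<tau> (inv k) z)"
  then obtain l where l: "l \<in> K" "h = g \<otimes> k \<otimes> l" "w = \<tau> (inv l) (\<tau> (inv k) z)"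
    by (auto simp: mem_orbit_iff)
  then have "h = g \<otimes> (k \<otimes> l)" "w = \<tau> (inv (k \<otimes> l)) z"
    using assms by (simp_all add: m_assoc K_carrier inv_mult_group rep_mult K_inv)
  then show "(h, w) \<in> \<theta> (g, z)"
    using K_mult[OF assms(2) l(1)] by (auto simp: mem_orbit_iff)
qed

lemma orbit_translate:
  assumes g: "g \<in> carrier G" and k: "k \<in> K"
  shows "\<theta> (g \<otimes> k, \<tau> (inv k) z) = \<theta> (g, z)"
proof
  have "g \<otimes> k \<otimes> inv k = g" and "\<tau> (inv (inv k)) (\<tau> (inv k) z) = z"
    using g k by (simp_all add: m_assoc K_carrier K_inv rep_one flip: rep_mult)
  \<comment> \<open>The reverse inclusion is the same lemma at the translated point, with
    \<open>inv k\<close> moving it back to \<open>(g, z)\<close>.\<close>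
  then show "\<theta> (g, z) \<subseteq> \<theta> (g \<otimes> k, \<tau> (inv k) z)"
    using orbit_translate_subset[of "g \<otimes> k" "inv k" "\<tau> (inv k) z"] g k
    by (simp add: K_carrier K_inv)
qed (rule orbit_translate_subset[OF assms])

text \<open>Since \<open>(g, z)\<close> lies in its own orbit, it is a \<open>K\<close>-translate of
  \<open>(h, w)\<close>, and the translating \<open>k\<close> is the inverse of
  \<open>inv g \<otimes> h\<close>. This form compares vectors over different base points:
  \<open>g = h\<close> gives injectivity on fibres, nearby points give continuity.\<close>

lemma orbit_eqD:
  assumes "g \<in> carrier G" and "h \<in> carrier G" and "\<theta> (g, z) = \<theta> (h, w)"
  shows "inv g \<otimes> h \<in> K" and "z = \<tau> (inv g \<otimes> h) w"
proof -
  obtain k where k: "k \<in> K" "g = h \<otimes> k" "z = \<tau> (inv k) w"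
    using orbit_self[OF assms(1), of z] assms(3) by (auto simp: mem_orbit_iff)
  then have "inv g \<otimes> h = inv k"
    using assms by (simp add: inv_mult_group m_assoc K_carrier)
  with k show "inv g \<otimes> h \<in> K" and "z = \<tau> (inv g \<otimes> h) w"
    by (simp_all add: K_inv)
qed

lemma orbit_inj:
  assumes "g \<in> carrier G" and "\<theta> (g, z) = \<theta> (g, w)"
  shows "z = w"
  using orbit_eqD(2)[OF assms(1) assms(1,2)] assms(1) by (simp add: rep_one)

lemma coset_translate:
  assumes "g \<in> carrier G" and "k \<in> K"
  shows "(g \<otimes> k) <# K = g <# K"
  using assms lcos_m_assoc[of K g k] coset_join3[of k K] subgroup_K K_carrier
  by (simp add: subgroup.subset)

text \<open>Any representative \<open>(h, w)\<close> of \<open>c\<close> has \<open>h\<close> in the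
  coset of \<open>g\<close>, so it can be moved along its orbit until its first component is
  \<open>g\<close>.\<close>

lemma bundle_fibre:
  assumes c: "c \<in> bundle_space G K \<tau>" and proj: "bundle_proj G K \<tau> c = g <# K"
    and g: "g \<in> carrier G"
  shows "\<exists>z. c = \<theta> (g, z)"
proof -
  obtain h w where h: "h \<in> carrier G" "c = \<theta> (h, w)"
    using c by (auto simp: bundle_space_def)
  then have "h <# K = g <# K"
    using proj bundle_proj_bundle_orbit by metis
  moreover have "g \<in> g <# K"
    using g K_one by (auto simp: l_coset_def intro!: bexI[of _ \<one>])
  ultimately obtain k where "k \<in> K" "g = h \<otimes> k"
    by (auto simp: l_coset_def)
  then show ?thesis
    using orbit_translate[OF h(1)] h(2) by metis
qed

section \<open>The function of type \<open>\<tau>\<close> belonging to a section\<close>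

lemma represents_iff:
  "function_represents_section G K \<tau> f u \<longleftrightarrow> (\<forall>g\<in>carrier G. u (g <# K) = \<theta> (g, f g))"
  by (auto simp: function_represents_section_def LCOSETS_def)

text \<open>The section depends only on the coset, so \<open>(g, f g)\<close> and
  \<open>(g \<otimes> k, f (g \<otimes> k))\<close> lie in one orbit. Moving the first pair by
  \<open>k\<close> puts both over \<open>g \<otimes> k\<close>, where \<open>orbit_inj\<close>
  compares the vectors.\<close>

lemma function_of_type_if_represents:
  assumes "f \<in> carrier G \<rightarrow>\<^sub>E UNIV" and "function_represents_section G K \<tau> f u"
  shows "function_of_type G K \<tau> f"
  unfolding function_of_type_def
proof (intro conjI ballI)
  fix g k
  assume g: "g \<in> carrier G" and k: "k \<in> K"
  then have "\<theta> (g \<otimes> k, f (g \<otimes> k)) = \<theta> (g, f g)"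
    using assms(2) coset_translate[OF g k] K_carrier[OF k] by (metis represents_iff m_closed)
  also have "\<dots> = \<theta> (g \<otimes> k, \<tau> (inv k) (f g))"
    using orbit_translate[OF g k] by simp
  finally show "f (g \<otimes> k) = \<tau> (inv k) (f g)"
    using orbit_inj g K_carrier[OF k] by blast
qed (rule assms(1))

lemma ex1_function_of_type:
  assumes "bundle_section G K \<tau> u"
  shows "\<exists>!f. function_of_type G K \<tau> f \<and> function_represents_section G K \<tau> f u"
proof -
  have "\<exists>z. u (g <# K) = \<theta> (g, z)" if "g \<in> carrier G" for g
  proof (rule bundle_fibre[OF _ _ that])
    have "g <# K \<in> lcosets K"
      using that by (auto simp: LCOSETS_def)
    with assms show "u (g <# K) \<in> bundle_space G K \<tau>"
      and "bundle_proj G K \<tau> (u (g <# K)) = g <# K"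
      by (auto simp: bundle_section_def)
  qed
  then obtain f where f: "\<forall>g\<in>carrier G. u (g <# K) = \<theta> (g, f g)"
    by metis
  show ?thesis
  proof (rule ex1I)
    \<comment> \<open>Choice leaves \<open>f\<close> arbitrary off the carrier; restricting makes it
      \<open>undefined\<close> there, as membership in \<open>\<rightarrow>\<^sub>E\<close> demands
      and uniqueness needs.\<close>
    have "function_represents_section G K \<tau> (restrict f (carrier G)) u"
      using f by (simp add: represents_iff)
    then show "function_of_type G K \<tau> (restrict f (carrier G)) \<and>
        function_represents_section G K \<tau> (restrict f (carrier G)) u"
      by (simp add: function_of_type_if_represents)
  next
    fix f'
    assume f': "function_of_type G K \<tau> f' \<and> function_represents_section G K \<tau> f' u"
    then have "f' \<in> extensional (carrier G)"
      by (auto simp: function_of_type_def PiE_def)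
    moreover have "f' g = f g" if "g \<in> carrier G" for g
      using f f' that orbit_inj by (metis represents_iff)
    ultimately show "f' = restrict f (carrier G)"
      by (intro extensionalityI[of _ "carrier G"]) auto
  qed
qed

section \<open>Openness of the orbit map\<close>

lemma bundle_action_continuous:
  assumes "k \<in> K"
  shows "continuous_map (prod_topology T euclidean) (prod_topology T euclidean)
           (bundle_action G \<tau> k)"
proof -
  have "continuous_map (prod_topology T euclidean) T (\<lambda>p. fst p \<otimes> k)"
    using continuous_map_compose[OF continuous_map_fst
        continuous_map_right_translation[OF K_carrier[OF assms]]]
    by (simp add: o_def)
  moreover have "continuous_map (prod_topology T euclidean) euclidean (\<lambda>p. \<tau> (inv k) (snd p))"
    using continuous_map_compose[OF continuous_map_snd
        unitary_operator_continuous[OF unitary[OF K_inv[OF assms]]]]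
    by (simp add: o_def)
  ultimately show ?thesis
    unfolding bundle_action_def case_prod_unfold by (rule continuous_map_pairedI)
qed

lemma open_map_orbit: "open_map (prod_topology T euclidean) (bundle_topology G T K \<tau>) \<theta>"
  unfolding open_map_def bundle_topology_def openin_quotient_topology
proof (intro allI impI conjI)
  fix U :: "('a \<times> 'h) set"
  assume U: "openin (prod_topology T euclidean) U"
  let ?X = "prod_topology T euclidean :: ('a \<times> 'h) topology"
  have sub: "U \<subseteq> topspace ?X"
    using U by (rule openin_subset)
  then show "\<theta> ` U \<subseteq> \<theta> ` topspace ?X"
    by blast
  \<comment> \<open>The saturation of \<open>U\<close> consists of the points that some
    \<open>k\<close> in \<open>K\<close> moves into \<open>U\<close>. It is thus a union of
    preimages of \<open>U\<close> under the continuous maps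
    \<open>bundle_action G \<tau> k\<close>.\<close>
  have "{p \<in> topspace ?X. \<theta> p \<in> \<theta> ` U} =
        (\<Union>k\<in>K. {p \<in> topspace ?X. bundle_action G \<tau> k p \<in> U})"
  proof (intro equalityI subsetI)
    fix p
    assume "p \<in> {p \<in> topspace ?X. \<theta> p \<in> \<theta> ` U}"
    then obtain q where p: "p \<in> topspace ?X" and q: "q \<in> U" "\<theta> p = \<theta> q"
      by blast
    have "q \<in> \<theta> q"
      using q(1) sub orbit_self[of "fst q" "snd q"] by (auto simp: topspace_eq)
    then obtain k where "k \<in> K" "q = bundle_action G \<tau> k p"
      unfolding q(2)[symmetric] by (auto simp: bundle_orbit_def)
    with p q(1) show "p \<in> (\<Union>k\<in>K. {p \<in> topspace ?X. bundle_action G \<tau> k p \<in> U})"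
      by blast
  next
    fix p
    assume "p \<in> (\<Union>k\<in>K. {p \<in> topspace ?X. bundle_action G \<tau> k p \<in> U})"
    then obtain k where p: "p \<in> topspace ?X" and k: "k \<in> K" "bundle_action G \<tau> k p \<in> U"
      by blast
    have "\<theta> p = \<theta> (bundle_action G \<tau> k p)"
      using p orbit_translate[OF _ k(1), of "fst p" "snd p"]
      by (auto simp: topspace_eq bundle_action_def)
    with p k show "p \<in> {p \<in> topspace ?X. \<theta> p \<in> \<theta> ` U}"
      by blast
  qed
  also have "openin ?X \<dots>"
    using bundle_action_continuous U by (blast intro: openin_continuous_map_preimage)
  finally show "openin ?X {p \<in> topspace ?X. \<theta> p \<in> \<theta> ` U}" .
qed

section \<open>Continuity of the section and of its function\<close>

text \<open>By the universal property of the quotient map from \<open>G\<close> to the cosets,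
  \<open>u\<close> may be tested after composition with it; that composite agrees with the orbit of
  \<open>(g, f g)\<close> on the carrier.\<close>

lemma continuous_section_iff_orbit:
  assumes "function_represents_section G K \<tau> f u"
  shows "continuous_map (coset_topology G T K) (bundle_topology G T K \<tau>) u \<longleftrightarrow>
         continuous_map T (bundle_topology G T K \<tau>) (\<lambda>g. \<theta> (g, f g))"
proof -
  have "continuous_map (coset_topology G T K) (bundle_topology G T K \<tau>) u \<longleftrightarrow>
        continuous_map T (bundle_topology G T K \<tau>) (u \<circ> (\<lambda>g. g <# K))"
    unfolding coset_topology_def
    by (rule continuous_compose_quotient_map_eq[symmetric, OF quotient_map_quotient_topology])
  also have "\<dots> \<longleftrightarrow> continuous_map T (bundle_topology G T K \<tau>) (\<lambda>g. \<theta> (g, f g))"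
    using assms by (auto simp: topspace_eq represents_iff elim!: continuous_map_eq)
  finally show ?thesis .
qed

lemma continuous_orbit_if_continuous:
  assumes "continuous_map T euclidean f"
  shows "continuous_map T (bundle_topology G T K \<tau>) (\<lambda>g. \<theta> (g, f g))"
proof -
  have "continuous_map T (prod_topology T euclidean) (\<lambda>g. (g, f g))"
    using assms by (simp add: continuous_map_pairedI)
  then show ?thesis
    using continuous_map_compose quotient_imp_continuous_map[OF quotient_map_quotient_topology]
    unfolding bundle_topology_def by (fastforce simp: o_def)
qed

text \<open>The map sending \<open>(a, b)\<close> to \<open>inv a \<otimes> b\<close> is continuous
  and takes \<open>(g, g)\<close> to \<open>\<one>\<close>, where \<open>\<tau>\<close> fixes
  \<open>z\<close>. Strong continuity is available only on \<open>K\<close>, hence the proviso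
  \<open>inv a \<otimes> b \<in> K\<close>.\<close>

lemma rep_near_diagonal:
  assumes g: "g \<in> carrier G" and "e > 0"
  obtains A where "openin T A" "g \<in> A"
    "\<And>a b. a \<in> A \<Longrightarrow> b \<in> A \<Longrightarrow> inv a \<otimes> b \<in> K \<Longrightarrow> dist (\<tau> (inv a \<otimes> b) z) z < e"
proof -
  have "openin (subtopology T K) {k \<in> topspace (subtopology T K). \<tau> k z \<in> ball z e}"
    by (rule openin_continuous_map_preimage[OF rep_continuous]) simp
  \<comment> \<open>A set open in \<open>K\<close> is the trace of some \<open>W\<close> open in
    \<open>G\<close>; this \<open>W\<close> can be pulled back along the map on all of
    \<open>G \<times> G\<close>.\<close>
  then obtain W where W: "openin T W"
    "{k \<in> topspace (subtopology T K). \<tau> k z \<in> ball z e} = W \<inter> K"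
    by (auto simp: openin_subtopology)
  have "\<one> \<in> {k \<in> topspace (subtopology T K). \<tau> k z \<in> ball z e}"
    using K_one \<open>e > 0\<close> by (simp add: topspace_eq rep_one)
  then have "\<one> \<in> W"
    unfolding W(2) by blast
  define D where "D = {p \<in> topspace (prod_topology T T). inv (fst p) \<otimes> snd p \<in> W}"
  have "continuous_map (prod_topology T T) T (\<lambda>p. inv (fst p) \<otimes> snd p)"
    by (intro continuous_map_mult continuous_map_inv continuous_map_fst continuous_map_snd)
  then have "openin (prod_topology T T) D"
    unfolding D_def using W(1) by (rule openin_continuous_map_preimage)
  moreover have "(g, g) \<in> D"
    using g \<open>\<one> \<in> W\<close> by (simp add: D_def topspace_eq)
  ultimately obtain A B where AB: "openin T A" "openin T B" "g \<in> A" "g \<in> B" "A \<times> B \<subseteq> D"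
    unfolding openin_prod_topology_alt by metis
  show thesis
  \<comment> \<open>Intersecting the two sides of the box gives one neighbourhood of
    \<open>g\<close> serving both variables.\<close>
  proof (rule that[of "A \<inter> B"])
    fix a b
    assume "a \<in> A \<inter> B" "b \<in> A \<inter> B" and k: "inv a \<otimes> b \<in> K"
    then have "(a, b) \<in> D"
      using AB(5) by blast
    then have "inv a \<otimes> b \<in> W \<inter> K"
      using k by (simp add: D_def)
    then have "\<tau> (inv a \<otimes> b) z \<in> ball z e"
      unfolding W(2)[symmetric] by blast
    then show "dist (\<tau> (inv a \<otimes> b) z) z < e"
      by (simp add: dist_commute)
  qed (use AB in auto)
qed

lemma continuous_if_continuous_orbit:
  assumes cont: "continuous_map T (bundle_topology G T K \<tau>) (\<lambda>g. \<theta> (g, f g))"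
  shows "continuous_map T euclidean f"
proof -
  have "\<exists>U. openin T U \<and> g \<in> U \<and> (\<forall>a\<in>U. f a \<in> ball (f g) e)"
    if g: "g \<in> carrier G" and e: "e > 0" for g e
  proof -
    obtain A where A: "openin T A" "g \<in> A" and
      near: "\<And>a b. a \<in> A \<Longrightarrow> b \<in> A \<Longrightarrow> inv a \<otimes> b \<in> K \<Longrightarrow>
                     dist (\<tau> (inv a \<otimes> b) (f g)) (f g) < e / 2"
      using rep_near_diagonal[OF g half_gt_zero[OF e]] by metis
    \<comment> \<open>The image of a box around \<open>(g, f g)\<close>, open because
      \<open>\<theta>\<close> is an open map.\<close>
    let ?O = "\<theta> ` (A \<times> ball (f g) (e / 2))"
    have "openin (bundle_topology G T K \<tau>) ?O"
      using open_map_orbit A(1) by (simp add: open_map_def openin_prod_Times_iff)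
    then have "openin T {a \<in> topspace T. \<theta> (a, f a) \<in> ?O}"
      using cont by (rule openin_continuous_map_preimage[rotated])
    moreover have "g \<in> {a \<in> topspace T. \<theta> (a, f a) \<in> ?O}"
      using g A(2) e by (auto simp: topspace_eq)
    moreover have "f a \<in> ball (f g) e" if a: "a \<in> A" "\<theta> (a, f a) \<in> ?O" for a
    proof -
      obtain b w where b: "b \<in> A" "w \<in> ball (f g) (e / 2)" "\<theta> (a, f a) = \<theta> (b, w)"
        using a(2) by auto
      let ?k = "inv a \<otimes> b"
      have "a \<in> carrier G" "b \<in> carrier G"
        using a(1) b(1) openin_subset[OF A(1)] by (auto simp: topspace_eq)
      then have k: "?k \<in> K" "f a = \<tau> ?k w"
        using orbit_eqD b(3) by blast+
      \<comment> \<open>Both \<open>w\<close> and \<open>?k\<close> vary with \<open>a\<close>,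
        while \<open>near\<close> concerns the fixed vector \<open>f g\<close>. Isometry of
        \<open>\<tau> ?k\<close> reduces the first term to the distance from \<open>w\<close> to
        \<open>f g\<close>; \<open>near\<close> bounds the second.\<close>
      have "dist (f a) (f g) \<le> dist (\<tau> ?k w) (\<tau> ?k (f g)) + dist (\<tau> ?k (f g)) (f g)"
        unfolding k(2) by (rule dist_triangle)
      also have "\<dots> < e / 2 + e / 2"
        using b(2) near[OF a(1) b(1) k(1)]
        by (intro add_strict_mono) (auto simp: unitary_operator_dist[OF unitary[OF k(1)]] dist_commute)
      finally show ?thesis
        by (simp add: dist_commute)
    qed
    ultimately show ?thesis
      using A by (intro exI[of _ "A \<inter> {a \<in> topspace T. \<theta> (a, f a) \<in> ?O}"]) auto
  qed
  then show ?thesis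
    using Met_TC.continuous_map_to_metric[of T f] by (simp add: topspace_eq mball_eq_ball)
qed

lemma continuous_section_iff:
  assumes "function_represents_section G K \<tau> f u"
  shows "continuous_map (coset_topology G T K) (bundle_topology G T K \<tau>) u \<longleftrightarrow>
         continuous_map T euclidean f"
  using continuous_section_iff_orbit[OF assms] continuous_orbit_if_continuous
    continuous_if_continuous_orbit by blast

end

theorem proposition9p1p2:
  fixes G :: "('g, 'm) monoid_scheme"
    and T :: "'g topology"
    and K :: "'g set"
    and \<tau> :: "'g \<Rightarrow> 'h::chilbert_space \<Rightarrow> 'h"
    and u :: "'g set \<Rightarrow> ('g \<times> 'h) set"
  assumes "topological_group G T"
    and "compact_space T"
    and "subgroup K G"
    and "closedin T K"
    and "complex_finite_dim TYPE('h)"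
    and "unitary_representation (G\<lparr>carrier := K\<rparr>) (subtopology T K) \<tau>"
    and "irreducible_representation (G\<lparr>carrier := K\<rparr>) \<tau>"
    and "bundle_section G K \<tau> u"
  shows "(\<exists>!f. function_of_type G K \<tau> f \<and> function_represents_section G K \<tau> f u) \<and>
         (\<forall>f. function_of_type G K \<tau> f \<and> function_represents_section G K \<tau> f u \<longrightarrow>
            (continuous_map (coset_topology G T K) (bundle_topology G T K \<tau>) u
              \<longleftrightarrow> continuous_map T euclidean f))"
proof -
  interpret homogeneous_bundle G T K \<tau>
    by (intro homogeneous_bundle.intro homogeneous_bundle_axioms.intro assms)
  show ?thesis
    using ex1_function_of_type[OF assms(8)] continuous_section_iff by blast
qed

end
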